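(* Let $G$ be a CDF on $\mathbb{R}$ with finite second moment, mean $\mu_G$ and standard deviation $\sigma_G>0$, and let $\epsilon>0$, $\gamma>0$. Consider the worst-case problem $$\sup_{F\in\mathcal{M}^2(G;\epsilon)} V^F(X),\qquad V^F(X)=\mathbb{E}_F[X]+\gamma\,\mathbb{V}_F[X].$$ The equation $$\tan(\theta)-2\gamma\sigma_G-2\gamma\sqrt{\epsilon}\,\sin(\theta)=0,\qquad \theta\in\left(0,\tfrac{\pi}{2}\right),$$ has a unique root $\theta^*$, and the optimal quantile function of the worst-case distribution $F_{wo}$ (the maximizer of the problem) is given by $$F_{wo}^{-1}(t)=(\mu_G+\sqrt{\epsilon}\cos(\theta^* ))+(\sigma_G+\sqrt{\epsilon}\sin(\theta^* ))\,\frac{G^{-1}(t)-\mu_G}{\sigma_G}.$$ Moreover, the worst-case value is $$\sup_{F\in\mathcal{M}^2(G;\epsilon)}V^F(X)=\mu_G+\frac{\lambda^*\gamma}{\lambda^*-\gamma}\sigma_G^2+\frac{1}{4\lambda^*}+\lambda^*\epsilon,$$ where $\lambda^*$ is the unique solution in $(\gamma,\infty)$ of $$\frac{\gamma^2}{(\lambda-\gamma)^2}\sigma_G^2+\frac{1}{4\lambda^2}=\epsilon.$$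
   Context: For a CDF $F$ on $\mathbb{R}$, $F^{-1}(t)=\inf\{x\in\mathbb{R}:F(x)\ge t\}$ is its left-continuous quantile function. $\mathbb{E}_F[X]=\int_0^1F^{-1}(t)\,dt$ and $\mathbb{V}_F[X]=\int_0^1 (F^{-1}(t))^2dt-\left(\int_0^1F^{-1}(t)dt\right)^2$ are the mean and variance of a random variable $X$ with CDF $F$. The 2-Wasserstein distance between CDFs with finite second moments is $W_2(F,G)=\left(\int_0^1|F^{-1}(t)-G^{-1}(t)|^2dt\right)^{1/2}$. $\mathcal{M}^2(G;\epsilon)$ is the set of all CDFs $F$ on $\mathbb{R}$ with finite second moment such that $W_2(F,G)\le\sqrt{\epsilon}$. *)

theory Defs
  imports "HOL-Probability.Probability"
begin

definition is_cdf :: "(real \<Rightarrow> real) \<Rightarrow> bool" where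
  "is_cdf F \<longleftrightarrow> (\<exists>M. real_distribution M \<and> cdf M = F)"

(* A CDF determines its law (cdf_unique), so the existential refers to the one law with CDF F. *)
definition finite_second_moment :: "(real \<Rightarrow> real) \<Rightarrow> bool" where
  "finite_second_moment F \<longleftrightarrow>
     (\<exists>M. real_distribution M \<and> cdf M = F \<and> integrable M (\<lambda>x. x\<^sup>2))"

(* Only the values for 0 < t < 1 are meaningful: elsewhere the set may be empty or unbounded
   below, and Inf on the reals is then unspecified.  The integrals below are therefore over
   the open unit interval. *)
definition quantile :: "(real \<Rightarrow> real) \<Rightarrow> real \<Rightarrow> real" where
  "quantile F t = Inf {x. F x \<ge> t}"

definition mean :: "(real \<Rightarrow> real) \<Rightarrow> real" where
  "mean F = (LBINT t:{0<..<1}. quantile F t)"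

definition var :: "(real \<Rightarrow> real) \<Rightarrow> real" where
  "var F = (LBINT t:{0<..<1}. (quantile F t)\<^sup>2) - (LBINT t:{0<..<1}. quantile F t)\<^sup>2"

definition std_dev :: "(real \<Rightarrow> real) \<Rightarrow> real" where
  "std_dev F = sqrt (var F)"

definition W2 :: "(real \<Rightarrow> real) \<Rightarrow> (real \<Rightarrow> real) \<Rightarrow> real" where
  "W2 F G = sqrt (LBINT t:{0<..<1}. \<bar>quantile F t - quantile G t\<bar>\<^sup>2)"

definition W2_ball :: "(real \<Rightarrow> real) \<Rightarrow> real \<Rightarrow> (real \<Rightarrow> real) set" where
  "W2_ball G \<epsilon> = {F. is_cdf F \<and> finite_second_moment F \<and> W2 F G \<le> sqrt \<epsilon>}"

definition mean_var :: "real \<Rightarrow> (real \<Rightarrow> real) \<Rightarrow> real" where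
  "mean_var \<gamma> F = mean F + \<gamma> * var F"

definition worst_case_cdf :: "(real \<Rightarrow> real) \<Rightarrow> real \<Rightarrow> real \<Rightarrow> (real \<Rightarrow> real) \<Rightarrow> bool" where
  "worst_case_cdf G \<epsilon> \<gamma> F \<longleftrightarrow> is_arg_max (mean_var \<gamma>) (\<lambda>F. F \<in> W2_ball G \<epsilon>) F"

definition angle_root :: "real \<Rightarrow> real \<Rightarrow> real \<Rightarrow> real \<Rightarrow> bool" where
  "angle_root \<sigma> \<epsilon> \<gamma> \<theta> \<longleftrightarrow>
     \<theta> \<in> {0<..<pi/2} \<and> tan \<theta> - 2 * \<gamma> * \<sigma> - 2 * \<gamma> * sqrt \<epsilon> * sin \<theta> = 0"

definition multiplier_root :: "real \<Rightarrow> real \<Rightarrow> real \<Rightarrow> real \<Rightarrow> bool" where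
  "multiplier_root \<sigma> \<epsilon> \<gamma> l \<longleftrightarrow>
     l \<in> {\<gamma><..} \<and> \<gamma>\<^sup>2 / (l - \<gamma>)\<^sup>2 * \<sigma>\<^sup>2 + 1 / (4 * l\<^sup>2) = \<epsilon>"

end

theory Submission
  imports Defs
begin

text \<open>
  Put \<open>X = F\<^sup>-\<^sup>1\<close> and \<open>Y = G\<^sup>-\<^sup>1\<close>, viewed as random variables on the unit interval, and let \<open>l\<close> be the
  multiplier. The Lagrangian \<open>E X + \<gamma> Var X - l E (X - Y)\<^sup>2\<close> is a strictly concave quadratic in \<open>X\<close>
  (as \<open>l > \<gamma>\<close>) whose maximizer is the affine image \<open>Z = E Y + 1/(2l) + l/(l - \<gamma>) (Y - E Y)\<close>;
  completing the square shows that it falls short of its maximum by at least \<open>(l - \<gamma>) E (X - Z)\<^sup>2\<close>.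
  As \<open>Z\<close> is increasing in \<open>Y\<close>, it is again a quantile function, and the multiplier equation says
  \<open>E (Z - Y)\<^sup>2 = \<epsilon>\<close>. Hence \<open>Z\<close> is optimal, and any other optimum agrees with it almost everywhere.
  The angle merely parametrizes the multiplier equation: \<open>1/(2l) = \<surd>\<epsilon> cos \<theta>\<close> and
  \<open>\<gamma> \<sigma>/(l - \<gamma>) = \<surd>\<epsilon> sin \<theta>\<close>.
\<close>

section \<open>Completing the square\<close>

lemma integrable_mult_of_squares:
  fixes X Y :: "'a \<Rightarrow> real"
  assumes [measurable]: "X \<in> borel_measurable M" "Y \<in> borel_measurable M"
    and X: "integrable M (\<lambda>x. (X x)\<^sup>2)" and Y: "integrable M (\<lambda>x. (Y x)\<^sup>2)"
  shows "integrable M (\<lambda>x. X x * Y x)"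
proof (rule Bochner_Integration.integrable_bound)
  show "integrable M (\<lambda>x. (X x)\<^sup>2 + (Y x)\<^sup>2)"
    using X Y by simp
  have "\<bar>a * b\<bar> \<le> a\<^sup>2 + b\<^sup>2" for a b :: real
  proof -
    have "2 * (\<bar>a\<bar> * \<bar>b\<bar>) \<le> a\<^sup>2 + b\<^sup>2"
      using sum_squares_bound[of "\<bar>a\<bar>" "\<bar>b\<bar>"] by simp
    moreover have "0 \<le> \<bar>a\<bar> * \<bar>b\<bar>" by simp
    ultimately show ?thesis unfolding abs_mult by linarith
  qed
  then show "AE x in M. norm (X x * Y x) \<le> norm ((X x)\<^sup>2 + (Y x)\<^sup>2)"
    by auto
qed measurable

text \<open>The part of the Lagrangian quadratic in \<open>X\<close> is -(l - \<gamma>) E X^2 -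
  \<gamma> (E X)^2, which is why two squares appear: a mean square and a squared mean. The identity
  is purely algebraic; signs enter only when it is turned into a bound.\<close>

lemma (in prob_space) lagrangian_complete_square:
  fixes X Y :: "'a \<Rightarrow> real" and l \<gamma> :: real
  defines "Z \<equiv> \<lambda>x. expectation Y + 1 / (2 * l) + l / (l - \<gamma>) * (Y x - expectation Y)"
  assumes [measurable]: "random_variable borel X" "random_variable borel Y"
    and X2: "integrable M (\<lambda>x. (X x)\<^sup>2)" and Y2: "integrable M (\<lambda>x. (Y x)\<^sup>2)"
    and l: "l \<noteq> 0" "l \<noteq> \<gamma>"
  shows "expectation X + \<gamma> * variance X
      + (l - \<gamma>) * expectation (\<lambda>x. (X x - Z x)\<^sup>2) + \<gamma> * (expectation (\<lambda>x. X x - Z x))\<^sup>2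
    = expectation Y + l * \<gamma> / (l - \<gamma>) * variance Y + 1 / (4 * l)
      + l * expectation (\<lambda>x. (X x - Y x)\<^sup>2)"
proof -
  have X1: "integrable M X" and Y1: "integrable M Y"
    using X2 Y2 by (auto intro: square_integrable_imp_integrable)
  have XY: "integrable M (\<lambda>x. X x * Y x)"
    using X2 Y2 by (intro integrable_mult_of_squares) auto
  define x y x2 y2 xy where defs: "x = expectation X" "y = expectation Y"
    "x2 = expectation (\<lambda>x. (X x)\<^sup>2)" "y2 = expectation (\<lambda>x. (Y x)\<^sup>2)"
    "xy = expectation (\<lambda>x. X x * Y x)"
  define k c where kc: "k = l / (l - \<gamma>)" "c = y + 1 / (2 * l) - k * y"
  \<comment> \<open>Used twice: with \<open>c\<close> and \<open>k\<close> for the distance to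
    \<open>Z\<close>, with 0 and 1 for the distance to \<open>Y\<close>.\<close>
  have quad: "expectation (\<lambda>x. (X x - (a + b * Y x))\<^sup>2)
      = x2 + a\<^sup>2 + b\<^sup>2 * y2 - 2 * a * x - 2 * b * xy + 2 * a * b * y" for a b
  proof -
    have "expectation (\<lambda>x. (X x - (a + b * Y x))\<^sup>2)
      = expectation (\<lambda>x. (X x)\<^sup>2 + a\<^sup>2 + b\<^sup>2 * (Y x)\<^sup>2 - 2 * a * X x - 2 * b * (X x * Y x)
          + 2 * a * b * Y x)"
      by (intro Bochner_Integration.integral_cong) (auto simp: power2_eq_square algebra_simps)
    then show ?thesis
      using X1 Y1 X2 Y2 XY by (simp add: defs prob_space)
  qed
  have Z: "Z = (\<lambda>x. c + k * Y x)"
    by (auto simp: Z_def kc defs algebra_simps)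
  have D1: "expectation (\<lambda>x. X x - Z x) = x - c - k * y"
    using X1 Y1 by (simp add: Z defs prob_space)
  have D2: "expectation (\<lambda>x. (X x - Z x)\<^sup>2)
      = x2 + c\<^sup>2 + k\<^sup>2 * y2 - 2 * c * x - 2 * k * xy + 2 * c * k * y"
    unfolding Z by (rule quad)
  have XmY: "expectation (\<lambda>x. (X x - Y x)\<^sup>2) = x2 + y2 - 2 * xy"
    using quad[of 0 1] by simp
  have vars: "variance X = x2 - x\<^sup>2" "variance Y = y2 - y\<^sup>2"
    using X1 Y1 X2 Y2 by (simp_all add: variance_eq defs)
  \<comment> \<open>With \<open>j\<close> and \<open>k\<close> in place of the reciprocals, both
    sides become polynomials linked by \<open>k * l = k * \<gamma> + l\<close> and
    \<open>j * l = 1 / 2\<close>.\<close>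
  define j where "j = 1 / (2 * l)"
  have kl: "k * l = k * \<gamma> + l" "j * l = 1 / 2" and kg: "l * \<gamma> / (l - \<gamma>) = k * \<gamma>" "1 / (4 * l) = j / 2"
    using l by (auto simp: kc j_def field_simps)
  have c: "c = y + j - k * y"
    by (simp add: kc j_def)
  \<comment> \<open>The difference of the two sides is an explicit combination of the defects of
    these two relations, hence zero.\<close>
  have "x + \<gamma> * (x2 - x\<^sup>2)
      + (l - \<gamma>) * (x2 + c\<^sup>2 + k\<^sup>2 * y2 - 2 * c * x - 2 * k * xy + 2 * c * k * y)
      + \<gamma> * (x - c - k * y)\<^sup>2
    - (y + k * \<gamma> * (y2 - y\<^sup>2) + j / 2 + l * (x2 + y2 - 2 * xy))
    = (x - y) * (1 - 2 * (j * l)) + j * (j * l - 1 / 2)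
      + ((y2 - y\<^sup>2) * (k + 1) - 2 * (xy - x * y)) * (k * l - (k * \<gamma> + l))"
    unfolding c by (simp add: algebra_simps power2_eq_square)
  also have "\<dots> = 0"
    by (simp add: kl)
  finally show ?thesis
    unfolding vars D1 D2 XmY kg by (simp add: defs)
qed

section \<open>Quantile functions as random variables\<close>

text \<open>The uniform law. Restricting the space rather than the integrand turns the set integrals
  of the definitions into expectations on a probability space.\<close>

abbreviation unit_lborel :: "real measure" where
  "unit_lborel \<equiv> restrict_space lborel {0<..<1}"

lemma prob_space_unit_lborel: "prob_space unit_lborel"
  by (auto simp: emeasure_restrict_space space_restrict_space intro!: prob_spaceI)

lemma set_integral_unit:
  fixes f :: "real \<Rightarrow> real"
  shows "(LBINT t:{0<..<1}. f t) = (\<integral>t. f t \<partial>unit_lborel)"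
  by (simp add: integral_restrict_space set_lebesgue_integral_def)

text \<open>Inverse transform sampling: \<open>quantile\<close> is the pseudoinverse studied in the
  locale \<open>cdf_distribution\<close>, whose facts carry over. The last part is the Galois
  connection between a CDF and its quantile function.\<close>

lemma quantile_cdf:
  assumes "real_distribution M"
  shows measurable_quantile: "quantile (cdf M) \<in> borel_measurable unit_lborel"
    and distr_quantile: "distr unit_lborel borel (quantile (cdf M)) = M"
    and quantile_le_iff: "0 < t \<Longrightarrow> t < 1 \<Longrightarrow> quantile (cdf M) t \<le> x \<longleftrightarrow> t \<le> cdf M x"
proof -
  interpret cdf_distribution M
    using assms by (simp add: cdf_distribution_def)
  have q: "quantile (cdf M) = (\<lambda>t. Inf {x. t \<le> cdf M x})"
    by (auto simp: quantile_def)
  have "measurable unit_lborel borel = measurable (restrict_space borel {0<..<1}) borel"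
    by (rule measurable_cong_sets) (auto simp: sets_restrict_space)
  then show "quantile (cdf M) \<in> borel_measurable unit_lborel"
    using measurable_CI by (simp add: q)
  show "distr unit_lborel borel (quantile (cdf M)) = M"
    using distr_I_eq_M by (simp add: q)
  show "quantile (cdf M) t \<le> x \<longleftrightarrow> t \<le> cdf M x" if "0 < t" "t < 1"
    unfolding q using pseudoinverse[OF that] by blast
qed

lemma quantile_L2:
  assumes "finite_second_moment F"
  shows "quantile F \<in> borel_measurable unit_lborel"
    and "integrable unit_lborel (\<lambda>t. (quantile F t)\<^sup>2)"
proof -
  obtain M where M: "real_distribution M" "cdf M = F" "integrable M (\<lambda>x. x\<^sup>2)"
    using assms(1) unfolding finite_second_moment_def by blast
  show m: "quantile F \<in> borel_measurable unit_lborel"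
    using measurable_quantile[OF M(1)] M(2) by simp
  have "integrable (distr unit_lborel borel (quantile F)) (\<lambda>x. x\<^sup>2)"
    using distr_quantile[OF M(1)] M(2,3) by simp
  then show "integrable unit_lborel (\<lambda>t. (quantile F t)\<^sup>2)"
    using m by (simp add: integrable_distr_eq)
qed

lemma mean_eq_expectation: "mean F = prob_space.expectation unit_lborel (quantile F)"
  unfolding mean_def by (rule set_integral_unit)

lemma var_eq_variance:
  assumes "finite_second_moment F"
  shows "var F = prob_space.variance unit_lborel (quantile F)"
proof -
  interpret prob_space unit_lborel
    by (rule prob_space_unit_lborel)
  note F = quantile_L2[OF assms]
  have iF: "integrable unit_lborel (quantile F)"
    using F by (rule square_integrable_imp_integrable)
  have "var F = (\<integral>t. (quantile F t)\<^sup>2 \<partial>unit_lborel) - (expectation (quantile F))\<^sup>2"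
    unfolding var_def set_integral_unit ..
  also have "\<dots> = variance (quantile F)"
    using variance_eq[OF iF F(2)] by simp
  finally show ?thesis .
qed

text \<open>Such quantile functions push the uniform law forward to the same law, and this law is
  the one with the given CDF. This upgrades almost everywhere uniqueness to equality of
  CDFs.\<close>

lemma cdf_eqI_AE_quantile:
  assumes "is_cdf F" "is_cdf H" "AE t in unit_lborel. quantile F t = quantile H t"
  shows "F = H"
proof -
  obtain M N where M: "real_distribution M" "cdf M = F" and N: "real_distribution N" "cdf N = H"
    using assms by (auto simp: is_cdf_def)
  have "distr unit_lborel borel (quantile F) = distr unit_lborel borel (quantile H)"
    using assms(3) measurable_quantile[OF M(1)] measurable_quantile[OF N(1)] M(2) N(2)
    by (intro distr_cong_AE) auto
  then have "M = N"
    using distr_quantile[OF M(1)] distr_quantile[OF N(1)] M(2) N(2) by simp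
  then show ?thesis
    using M N by simp
qed

text \<open>The witness is the CDF of the image of the law of \<open>G\<close> under the increasing
  map x to c + k x. Equality at every \<open>t\<close> of the open interval is what the pointwise
  formula for the worst case requires.\<close>

lemma affine_quantile_exists:
  assumes "finite_second_moment G" "k > 0"
  obtains H where "is_cdf H" "finite_second_moment H"
    "\<And>t. 0 < t \<Longrightarrow> t < 1 \<Longrightarrow> quantile H t = c + k * quantile G t"
proof -
  obtain M where M: "real_distribution M" "cdf M = G" "integrable M (\<lambda>x. x\<^sup>2)"
    using assms(1) unfolding finite_second_moment_def by blast
  interpret real_distribution M
    by (rule M(1))
  define N where "N = distr M borel (\<lambda>x. c + k * x)"
  have N: "real_distribution N"
    unfolding N_def by (rule real_distribution_distr) simp
  have cdfN: "cdf N x = cdf M ((x - c) / k)" for x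
  proof -
    have "(\<lambda>x. c + k * x) -` {..x} = {..(x - c) / k}"
      using \<open>k > 0\<close> by (auto simp: field_simps)
    then show ?thesis
      by (simp add: cdf_def N_def measure_distr)
  qed
  have "integrable M (\<lambda>x. x)"
    using M(3) by (rule square_integrable_imp_integrable[rotated]) simp
  then have "integrable M (\<lambda>x. c\<^sup>2 + 2 * c * k * x + k\<^sup>2 * x\<^sup>2)"
    using M(3) by simp
  moreover have "(\<lambda>x. c\<^sup>2 + 2 * c * k * x + k\<^sup>2 * x\<^sup>2) = (\<lambda>x. (c + k * x)\<^sup>2)"
    by (auto simp: power2_eq_square algebra_simps)
  ultimately have "integrable N (\<lambda>x. x\<^sup>2)"
    by (simp add: N_def integrable_distr_eq)
  moreover have "quantile (cdf N) t = c + k * quantile G t" if "0 < t" "t < 1" for t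
  proof -
    \<comment> \<open>By the Galois connection for \<open>G\<close>, the set whose infimum defines
      the new quantile is a closed half-line.\<close>
    have "t \<le> cdf N x \<longleftrightarrow> c + k * quantile G t \<le> x" for x
    proof -
      have "t \<le> cdf N x \<longleftrightarrow> quantile G t \<le> (x - c) / k"
        using quantile_le_iff[OF M(1) that] by (simp add: cdfN M(2))
      also have "\<dots> \<longleftrightarrow> c + k * quantile G t \<le> x"
        using \<open>k > 0\<close> by (simp add: field_simps)
      finally show ?thesis .
    qed
    then have "{x. t \<le> cdf N x} = {c + k * quantile G t..}"
      by auto
    then show ?thesis
      by (simp add: quantile_def)
  qed
  ultimately show ?thesis
    using N by (intro that[of "cdf N"]) (auto simp: is_cdf_def finite_second_moment_def)
qed

section \<open>The angle and the multiplier\<close>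

text \<open>Intermediate value theorem between 0, where the function is negative, and a point short
  of pi/2 where it is nonnegative.\<close>

lemma angle_root_exists:
  assumes "\<sigma> > 0" "\<epsilon> > 0" "\<gamma> > 0"
  shows "\<exists>\<theta>. angle_root \<sigma> \<epsilon> \<gamma> \<theta>"
proof -
  \<comment> \<open>As sin is at most 1, \<open>A\<close> bounds the terms subtracted from tan, so
    \<open>arctan A\<close> is a suitable right endpoint.\<close>
  define A where "A = 2 * \<gamma> * \<sigma> + 2 * \<gamma> * sqrt \<epsilon>"
  define f where "f = (\<lambda>\<theta>. tan \<theta> - 2 * \<gamma> * \<sigma> - 2 * \<gamma> * sqrt \<epsilon> * sin \<theta>)"
  have A: "0 < A"
    using assms by (simp add: A_def add_pos_pos)
  have b: "0 < arctan A" "arctan A < pi / 2"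
    using A arctan_ubound by (auto simp: zero_less_arctan_iff)
  have "sqrt \<epsilon> * sin (arctan A) \<le> sqrt \<epsilon>"
    using assms mult_left_mono[OF sin_le_one, of "sqrt \<epsilon>" "arctan A"] by simp
  then have "0 \<le> f (arctan A)"
    using assms mult_left_mono[of "sqrt \<epsilon> * sin (arctan A)" "sqrt \<epsilon>" "2 * \<gamma>"]
    by (simp add: f_def tan_arctan A_def mult.assoc)
  moreover have f0: "f 0 < 0"
    using assms by (simp add: f_def)
  moreover have "cos \<theta> \<noteq> 0" if "0 \<le> \<theta>" "\<theta> \<le> arctan A" for \<theta>
    using cos_gt_zero_pi[of \<theta>] that b by auto
  then have "continuous_on {0..arctan A} f"
    unfolding f_def by (auto intro!: continuous_intros)
  ultimately obtain \<theta> where \<theta>: "0 \<le> \<theta>" "\<theta> \<le> arctan A" "f \<theta> = 0"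
    using IVT'[of f 0 0 "arctan A"] b by auto
  have "\<theta> \<noteq> 0"
    using \<theta> f0 by auto
  then have "angle_root \<sigma> \<epsilon> \<gamma> \<theta>"
    using \<theta> b by (auto simp: angle_root_def f_def)
  then show ?thesis ..
qed

text \<open>The equation factors as sin \<theta> (1 / cos \<theta> - 2 \<gamma> sqrt \<epsilon>) = 2
  \<gamma> \<sigma>, where both factors on the left are strictly increasing.\<close>

lemma angle_root_unique:
  assumes "\<sigma> > 0" "\<gamma> > 0" "angle_root \<sigma> \<epsilon> \<gamma> \<theta>" "angle_root \<sigma> \<epsilon> \<gamma> \<theta>'"
  shows "\<theta> = \<theta>'"
proof -
  have False if "a < b" and a: "angle_root \<sigma> \<epsilon> \<gamma> a" and b: "angle_root \<sigma> \<epsilon> \<gamma> b" for a b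
  proof -
    let ?h = "\<lambda>\<theta>. 1 / cos \<theta> - 2 * \<gamma> * sqrt \<epsilon>"
    have ab: "0 < a" "b < pi / 2"
      using a b by (auto simp: angle_root_def)
    have eq: "sin a * ?h a = 2 * \<gamma> * \<sigma>" "sin b * ?h b = 2 * \<gamma> * \<sigma>"
      using a b by (auto simp: angle_root_def tan_def field_simps)
    have sin: "0 < sin a" "sin a < sin b"
      using ab \<open>a < b\<close> by (auto intro: sin_gt_zero sin_monotone_2pi)
    have "0 < cos b" "cos b < cos a"
      using ab \<open>a < b\<close> by (auto intro: cos_gt_zero cos_monotone_0_pi)
    then have h: "?h a < ?h b"
      by (simp add: frac_less2)
    \<comment> \<open>The factor \<open>?h\<close> can be negative near 0, but the equation forces
      it to be positive at a root; only then can the products be compared.\<close>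
    have "0 < sin a * ?h a"
      using eq assms by simp
    then have "0 < ?h a"
      using sin(1) by (simp only: zero_less_mult_pos)
    then have "sin a * ?h a < sin b * ?h b"
      using sin h by (intro mult_strict_mono) auto
    then show False
      using eq by simp
  qed
  then show ?thesis
    using assms(3,4) by (meson linorder_neqE_linordered_idom)
qed

text \<open>With s = sqrt \<epsilon> sin \<theta>, the choice of \<open>l\<close> gives 2 l s = tan
  \<theta>, so the angle equation becomes (l - \<gamma>) s = \<gamma> \<sigma>. This forces l >
  \<gamma>, and sin^2 + cos^2 = 1 yields the multiplier equation. Existence of the multiplier thus
  follows from that of the angle.\<close>

lemma multiplier_root_of_angle:
  assumes "\<sigma> > 0" "\<epsilon> > 0" "\<gamma> > 0" and \<theta>: "angle_root \<sigma> \<epsilon> \<gamma> \<theta>"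
  defines "l \<equiv> 1 / (2 * sqrt \<epsilon> * cos \<theta>)"
  shows "multiplier_root \<sigma> \<epsilon> \<gamma> l"
    and "1 / (2 * l) = sqrt \<epsilon> * cos \<theta>"
    and "l / (l - \<gamma>) = (\<sigma> + sqrt \<epsilon> * sin \<theta>) / \<sigma>"
proof -
  define s where "s = sqrt \<epsilon> * sin \<theta>"
  have pos: "0 < sin \<theta>" "0 < cos \<theta>" "0 < sqrt \<epsilon>"
    using \<theta> assms by (auto simp: angle_root_def intro: sin_gt_zero cos_gt_zero)
  then have s: "s > 0"
    by (simp add: s_def)
  have "tan \<theta> = 2 * \<gamma> * (\<sigma> + s)"
    using \<theta> by (simp add: angle_root_def s_def algebra_simps)
  moreover have "2 * l * s = tan \<theta>"
    using pos by (simp add: l_def s_def tan_def)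
  ultimately have ls: "(l - \<gamma>) * s = \<gamma> * \<sigma>"
    by (simp add: algebra_simps)
  then have "0 < (l - \<gamma>) * s"
    using assms by simp
  then have lg: "l - \<gamma> > 0"
    using s by (simp add: zero_less_mult_iff)
  show *: "1 / (2 * l) = sqrt \<epsilon> * cos \<theta>"
    by (simp add: l_def)
  have "l * \<sigma> = (\<sigma> + s) * (l - \<gamma>)"
    using ls by (simp add: algebra_simps)
  then show "l / (l - \<gamma>) = (\<sigma> + sqrt \<epsilon> * sin \<theta>) / \<sigma>"
    using lg assms(1) unfolding s_def by (simp add: frac_eq_eq)
  have s_eq: "\<gamma> * \<sigma> / (l - \<gamma>) = s"
    using ls lg by (simp add: field_simps)
  have "\<gamma>\<^sup>2 / (l - \<gamma>)\<^sup>2 * \<sigma>\<^sup>2 + 1 / (4 * l\<^sup>2) = (\<gamma> * \<sigma> / (l - \<gamma>))\<^sup>2 + (1 / (2 * l))\<^sup>2"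
    by (simp add: power_divide power_mult_distrib)
  also have "\<dots> = (sqrt \<epsilon>)\<^sup>2 * ((sin \<theta>)\<^sup>2 + (cos \<theta>)\<^sup>2)"
    unfolding s_eq * by (simp only: s_def power_mult_distrib distrib_left)
  finally show "multiplier_root \<sigma> \<epsilon> \<gamma> l"
    using lg assms(2) by (simp add: multiplier_root_def)
qed

text \<open>Beyond \<open>\<gamma>\<close> the first summand is nonincreasing and the second
  strictly decreasing.\<close>

lemma multiplier_root_unique:
  assumes "\<gamma> > 0" "multiplier_root \<sigma> \<epsilon> \<gamma> l" "multiplier_root \<sigma> \<epsilon> \<gamma> l'"
  shows "l = l'"
proof -
  have False if "a < b" and a: "multiplier_root \<sigma> \<epsilon> \<gamma> a" and b: "multiplier_root \<sigma> \<epsilon> \<gamma> b" for a b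
  proof -
    have ab: "\<gamma> < a"
      using a by (simp add: multiplier_root_def)
    have "\<gamma>\<^sup>2 / (b - \<gamma>)\<^sup>2 \<le> \<gamma>\<^sup>2 / (a - \<gamma>)\<^sup>2"
      using ab \<open>a < b\<close> by (intro divide_left_mono power_mono mult_pos_pos) auto
    then have "\<gamma>\<^sup>2 / (b - \<gamma>)\<^sup>2 * \<sigma>\<^sup>2 \<le> \<gamma>\<^sup>2 / (a - \<gamma>)\<^sup>2 * \<sigma>\<^sup>2"
      by (intro mult_right_mono) auto
    moreover have "a\<^sup>2 < b\<^sup>2" "0 < a\<^sup>2"
      using ab \<open>a < b\<close> assms(1) by (auto intro: power_strict_mono)
    then have "1 / (4 * b\<^sup>2) < 1 / (4 * a\<^sup>2)"
      by (intro divide_strict_left_mono mult_pos_pos) auto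
    ultimately show False
      using a b by (simp add: multiplier_root_def)
  qed
  then show ?thesis
    using assms(2,3) by (meson linorder_neqE_linordered_idom)
qed

section \<open>The worst case\<close>

lemma mean_var_complete_square:
  fixes l \<gamma> :: real
  defines "Z \<equiv> \<lambda>G t. mean G + 1 / (2 * l) + l / (l - \<gamma>) * (quantile G t - mean G)"
  assumes F: "finite_second_moment F" and G: "finite_second_moment G" and l: "l \<noteq> 0" "l \<noteq> \<gamma>"
  shows "mean_var \<gamma> F + (l - \<gamma>) * (\<integral>t. (quantile F t - Z G t)\<^sup>2 \<partial>unit_lborel)
      + \<gamma> * (\<integral>t. quantile F t - Z G t \<partial>unit_lborel)\<^sup>2
    = mean G + l * \<gamma> / (l - \<gamma>) * var G + 1 / (4 * l)
      + l * (\<integral>t. (quantile F t - quantile G t)\<^sup>2 \<partial>unit_lborel)"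
proof -
  interpret prob_space unit_lborel
    by (rule prob_space_unit_lborel)
  show ?thesis
    using lagrangian_complete_square[OF quantile_L2(1)[OF F] quantile_L2(1)[OF G]
        quantile_L2(2)[OF F] quantile_L2(2)[OF G] l]
    by (simp add: mean_var_def Z_def mean_eq_expectation var_eq_variance[OF F] var_eq_variance[OF G])
qed

lemma W2_ball_iff:
  "F \<in> W2_ball G \<epsilon> \<longleftrightarrow> is_cdf F \<and> finite_second_moment F \<and>
     (\<integral>t. (quantile F t - quantile G t)\<^sup>2 \<partial>unit_lborel) \<le> \<epsilon>"
  by (simp add: W2_ball_def W2_def set_integral_unit)

text \<open>Lagrangian duality: the completed square bounds every element of the ball by
  \<open>V\<close>, and the maximizer of the Lagrangian attains the bound because the multiplier
  equation makes the constraint tight.\<close>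

lemma worst_case_at_multiplier:
  assumes G: "finite_second_moment G" and \<gamma>: "\<gamma> > 0"
    and l: "multiplier_root (std_dev G) \<epsilon> \<gamma> l" and v: "var G \<ge> 0"
  defines "V \<equiv> mean G + l * \<gamma> / (l - \<gamma>) * var G + 1 / (4 * l) + l * \<epsilon>"
  obtains H where "H \<in> W2_ball G \<epsilon>" "mean_var \<gamma> H = V"
    "\<And>t. 0 < t \<Longrightarrow> t < 1 \<Longrightarrow>
       quantile H t = mean G + 1 / (2 * l) + l / (l - \<gamma>) * (quantile G t - mean G)"
    "\<And>F. F \<in> W2_ball G \<epsilon> \<Longrightarrow> mean_var \<gamma> F \<le> V"
    "\<And>F. F \<in> W2_ball G \<epsilon> \<Longrightarrow> mean_var \<gamma> F = V \<Longrightarrow> F = H"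
proof -
  interpret prob_space unit_lborel
    by (rule prob_space_unit_lborel)
  define k where "k = l / (l - \<gamma>)"
  define Z where "Z = (\<lambda>t. mean G + 1 / (2 * l) + k * (quantile G t - mean G))"
  have lg: "\<gamma> < l" and l_eq: "\<gamma>\<^sup>2 / (l - \<gamma>)\<^sup>2 * var G + 1 / (4 * l\<^sup>2) = \<epsilon>"
    using l v by (auto simp: multiplier_root_def std_dev_def)
  have ne: "l \<noteq> 0" "l \<noteq> \<gamma>" and k: "k > 0"
    using lg \<gamma> by (auto simp: k_def)
  note mG = quantile_L2[OF G]
  have iG: "integrable unit_lborel (quantile G)"
    using mG by (rule square_integrable_imp_integrable)
  obtain H where H: "is_cdf H" "finite_second_moment H"
    and "\<And>t. 0 < t \<Longrightarrow> t < 1 \<Longrightarrow>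
      quantile H t = (mean G + 1 / (2 * l) - k * mean G) + k * quantile G t"
    using affine_quantile_exists[OF G k] by blast
  then have HZ: "quantile H t = Z t" if "0 < t" "t < 1" for t
    using that by (simp add: Z_def algebra_simps)
  \<comment> \<open>\<open>Z\<close> and \<open>quantile H\<close> are known to agree only on the
    open interval, but this is the whole space of \<open>unit_lborel\<close>.\<close>
  have cong: "(\<integral>t. f (quantile H t) t \<partial>unit_lborel) = (\<integral>t. f (Z t) t \<partial>unit_lborel)"
    for f :: "real \<Rightarrow> real \<Rightarrow> real"
    using HZ by (intro Bochner_Integration.integral_cong) (auto simp: space_restrict_space)
  have Z_apply: "Z t = mean G + 1 / (2 * l) + k * (quantile G t - mean G)" for t
    by (simp add: Z_def)
  note square = mean_var_complete_square[OF _ G ne, folded k_def, folded Z_apply]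
  have dist: "(\<integral>t. (Z t - quantile G t)\<^sup>2 \<partial>unit_lborel) = \<epsilon>"
  proof -
    have k1: "k - 1 = \<gamma> / (l - \<gamma>)"
      using lg by (simp add: k_def field_simps)
    have "(\<integral>t. (Z t - quantile G t)\<^sup>2 \<partial>unit_lborel)
      = (\<integral>t. (k - 1)\<^sup>2 * (quantile G t - mean G)\<^sup>2
          + (k - 1) / l * (quantile G t - mean G) + 1 / (4 * l\<^sup>2) \<partial>unit_lborel)"
      using ne by (intro Bochner_Integration.integral_cong)
        (auto simp: Z_def power2_eq_square field_simps)
    \<comment> \<open>The cross term vanishes since \<open>quantile G\<close> is centred at its
      mean; the rest is the left side of the multiplier equation.\<close>
    also have "\<dots> = (k - 1)\<^sup>2 * var G + (k - 1) / l * (mean G - mean G) + 1 / (4 * l\<^sup>2)"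
    proof -
      have "integrable unit_lborel (\<lambda>t. (quantile G t - mean G)\<^sup>2)"
        using mG iG by (simp add: power2_diff)
      moreover have "prob {0<..<1} = 1"
        using prob_space by (simp add: space_restrict_space)
      ultimately show ?thesis
        using iG by (simp add: var_eq_variance[OF G] mean_eq_expectation)
    qed
    also have "\<dots> = \<epsilon>"
      using l_eq by (simp add: k1 power_divide)
    finally show ?thesis .
  qed
  \<comment> \<open>The squared mean of the deviation from \<open>Z\<close> is dropped here, but its
    mean square is kept: it is what forces uniqueness.\<close>
  have bound: "mean_var \<gamma> F + (l - \<gamma>) * (\<integral>t. (quantile F t - Z t)\<^sup>2 \<partial>unit_lborel) \<le> V"
    if "F \<in> W2_ball G \<epsilon>" for F
  proof -
    have F: "finite_second_moment F"
      "(\<integral>t. (quantile F t - quantile G t)\<^sup>2 \<partial>unit_lborel) \<le> \<epsilon>"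
      using that by (auto simp: W2_ball_iff)
    have "l * (\<integral>t. (quantile F t - quantile G t)\<^sup>2 \<partial>unit_lborel) \<le> l * \<epsilon>"
      using F(2) lg \<gamma> by (intro mult_left_mono) auto
    moreover have "0 \<le> \<gamma> * (\<integral>t. quantile F t - Z t \<partial>unit_lborel)\<^sup>2"
      using \<gamma> by simp
    ultimately show ?thesis
      using square[OF F(1)] unfolding V_def by linarith
  qed
  show ?thesis
  proof (rule that)
    show "H \<in> W2_ball G \<epsilon>"
      using H dist cong[of "\<lambda>z t. (z - quantile G t)\<^sup>2"] by (simp add: W2_ball_iff)
    \<comment> \<open>At \<open>H\<close> both completed squares vanish and the distance term is
      exactly \<open>\<epsilon>\<close>.\<close>
    show "mean_var \<gamma> H = V"
      using square[OF H(2)] cong[of "\<lambda>z t. (z - quantile G t)\<^sup>2"] cong[of "\<lambda>z t. z - Z t"]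
        cong[of "\<lambda>z t. (z - Z t)\<^sup>2"] dist
      by (simp add: V_def)
    show "quantile H t = mean G + 1 / (2 * l) + l / (l - \<gamma>) * (quantile G t - mean G)"
      if "0 < t" "t < 1" for t
      using HZ[OF that] by (simp add: Z_def k_def)
    show "mean_var \<gamma> F \<le> V" if "F \<in> W2_ball G \<epsilon>" for F
    proof -
      have "0 \<le> (l - \<gamma>) * (\<integral>t. (quantile F t - Z t)\<^sup>2 \<partial>unit_lborel)"
        using lg by simp
      then show ?thesis
        using bound[OF that] by linarith
    qed
    show "F = H" if "F \<in> W2_ball G \<epsilon>" "mean_var \<gamma> F = V" for F
    proof (rule cdf_eqI_AE_quantile)
      show "is_cdf F" "is_cdf H"
        using that H by (auto simp: W2_ball_def)
      have "finite_second_moment F"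
        using that by (simp add: W2_ball_def)
      note mF = quantile_L2[OF this]
      have iF: "integrable unit_lborel (quantile F)"
        using mF by (rule square_integrable_imp_integrable)
      have FG: "integrable unit_lborel (\<lambda>t. quantile F t * quantile G t)"
        using mF mG by (intro integrable_mult_of_squares)
      \<comment> \<open>A Bochner integral is 0 by default when the integrand is not integrable, so
        integrability must be known before a zero integral yields equality almost
        everywhere.\<close>
      have "integrable unit_lborel (\<lambda>t. (quantile F t - (a + b * quantile G t))\<^sup>2)" for a b
      proof -
        have "integrable unit_lborel (\<lambda>t. (quantile F t)\<^sup>2 + a\<^sup>2 + b\<^sup>2 * (quantile G t)\<^sup>2
            - 2 * a * quantile F t - 2 * b * (quantile F t * quantile G t) + 2 * a * b * quantile G t)"
          using mF mG iF iG FG by simp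
        then show ?thesis
          by (simp add: power2_eq_square algebra_simps)
      qed
      from this[of "mean G + 1 / (2 * l) - k * mean G" k]
      have int: "integrable unit_lborel (\<lambda>t. (quantile F t - Z t)\<^sup>2)"
        by (simp add: Z_def algebra_simps)
      have "(l - \<gamma>) * (\<integral>t. (quantile F t - Z t)\<^sup>2 \<partial>unit_lborel) \<le> 0"
        using bound[OF that(1)] that(2) by simp
      then have "(\<integral>t. (quantile F t - Z t)\<^sup>2 \<partial>unit_lborel) \<le> 0"
        using lg by (simp add: mult_le_0_iff)
      then have "(\<integral>t. (quantile F t - Z t)\<^sup>2 \<partial>unit_lborel) = 0"
        by (intro antisym) auto
      then have "AE t in unit_lborel. quantile F t = Z t"
        using integral_nonneg_eq_0_iff_AE[OF int] by simp
      then show "AE t in unit_lborel. quantile F t = quantile H t"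
        by (rule AE_mp) (auto simp: space_restrict_space HZ intro!: AE_I2)
    qed
  qed
qed

theorem theorem3p1:
  fixes G :: "real \<Rightarrow> real" and \<epsilon> \<gamma> \<mu>G \<sigma>G :: real
  assumes "is_cdf G" and "finite_second_moment G"
    and "\<mu>G = mean G" and "\<sigma>G = std_dev G" and "\<sigma>G > 0"
    and "\<epsilon> > 0" and "\<gamma> > 0"
  shows "(\<exists>!\<theta>. angle_root \<sigma>G \<epsilon> \<gamma> \<theta>) \<and>
    (\<exists>!F. worst_case_cdf G \<epsilon> \<gamma> F) \<and>
    (\<forall>\<theta> F. angle_root \<sigma>G \<epsilon> \<gamma> \<theta> \<longrightarrow> worst_case_cdf G \<epsilon> \<gamma> F \<longrightarrow>
       (\<forall>t\<in>{0<..<1}. quantile F t =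
          (\<mu>G + sqrt \<epsilon> * cos \<theta>) + (\<sigma>G + sqrt \<epsilon> * sin \<theta>) * ((quantile G t - \<mu>G) / \<sigma>G))) \<and>
    (\<exists>!l. multiplier_root \<sigma>G \<epsilon> \<gamma> l) \<and>
    bdd_above (mean_var \<gamma> ` W2_ball G \<epsilon>) \<and>
    (\<forall>l. multiplier_root \<sigma>G \<epsilon> \<gamma> l \<longrightarrow>
       (SUP F\<in>W2_ball G \<epsilon>. mean_var \<gamma> F) =
         \<mu>G + l * \<gamma> / (l - \<gamma>) * \<sigma>G\<^sup>2 + 1 / (4 * l) + l * \<epsilon>)"
proof -
  note pos = \<open>\<sigma>G > 0\<close> \<open>\<epsilon> > 0\<close> \<open>\<gamma> > 0\<close>
  have var: "var G = \<sigma>G\<^sup>2" "var G \<ge> 0"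
    using assms(4,5) by (auto simp: std_dev_def)
  obtain \<theta> where \<theta>: "angle_root \<sigma>G \<epsilon> \<gamma> \<theta>"
    using angle_root_exists[OF pos] by blast
  define l where "l = 1 / (2 * sqrt \<epsilon> * cos \<theta>)"
  note l = multiplier_root_of_angle[OF pos \<theta>, folded l_def]
  define V where "V = \<mu>G + l * \<gamma> / (l - \<gamma>) * \<sigma>G\<^sup>2 + 1 / (4 * l) + l * \<epsilon>"
  obtain H where H: "H \<in> W2_ball G \<epsilon>" "mean_var \<gamma> H = V"
      "\<And>t. 0 < t \<Longrightarrow> t < 1 \<Longrightarrow>
         quantile H t = \<mu>G + 1 / (2 * l) + l / (l - \<gamma>) * (quantile G t - \<mu>G)"
    and max: "\<And>F. F \<in> W2_ball G \<epsilon> \<Longrightarrow> mean_var \<gamma> F \<le> V"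
    and uniq: "\<And>F. F \<in> W2_ball G \<epsilon> \<Longrightarrow> mean_var \<gamma> F = V \<Longrightarrow> F = H"
    by (rule worst_case_at_multiplier[OF assms(2) \<open>\<gamma> > 0\<close> l(1)[unfolded assms(4)] var(2),
          unfolded var(1), folded assms(3), folded V_def]) (rule that)
  \<comment> \<open>An arg max is not worse than \<open>H\<close> and not above \<open>V\<close>, so
    it has value \<open>V\<close> and must be \<open>H\<close>.\<close>
  have wc: "worst_case_cdf G \<epsilon> \<gamma> F \<longleftrightarrow> F = H" for F
  proof
    assume "worst_case_cdf G \<epsilon> \<gamma> F"
    then have "F \<in> W2_ball G \<epsilon>" "\<not> mean_var \<gamma> F < mean_var \<gamma> H"
      using H(1) by (auto simp: worst_case_cdf_def is_arg_max_def)
    then show "F = H"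
      using uniq[of F] max[of F] H(2) by simp
  next
    assume "F = H"
    then show "worst_case_cdf G \<epsilon> \<gamma> F"
      using H max by (auto simp: worst_case_cdf_def is_arg_max_def not_less)
  qed
  have \<theta>_uniq: "\<theta>' = \<theta>" if "angle_root \<sigma>G \<epsilon> \<gamma> \<theta>'" for \<theta>'
    using angle_root_unique[OF pos(1,3) that \<theta>] .
  have l_uniq: "l' = l" if "multiplier_root \<sigma>G \<epsilon> \<gamma> l'" for l'
    using multiplier_root_unique[OF pos(3) that l(1)] .
  show ?thesis
  proof (intro conjI)
    show "\<exists>!\<theta>. angle_root \<sigma>G \<epsilon> \<gamma> \<theta>"
      using \<theta> \<theta>_uniq by (rule ex1I)
    show "\<exists>!F. worst_case_cdf G \<epsilon> \<gamma> F"
      by (simp add: wc)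
    show "\<exists>!l. multiplier_root \<sigma>G \<epsilon> \<gamma> l"
      using l(1) l_uniq by (rule ex1I)
    \<comment> \<open>Without boundedness the real-valued \<open>SUP\<close> would be
      unspecified.\<close>
    show "bdd_above (mean_var \<gamma> ` W2_ball G \<epsilon>)"
      using max by (rule bdd_aboveI2)
    show "\<forall>\<theta> F. angle_root \<sigma>G \<epsilon> \<gamma> \<theta> \<longrightarrow> worst_case_cdf G \<epsilon> \<gamma> F \<longrightarrow>
       (\<forall>t\<in>{0<..<1}. quantile F t =
          (\<mu>G + sqrt \<epsilon> * cos \<theta>) + (\<sigma>G + sqrt \<epsilon> * sin \<theta>) * ((quantile G t - \<mu>G) / \<sigma>G))"
    proof (intro allI impI ballI)
      fix \<theta>' F t
      assume "angle_root \<sigma>G \<epsilon> \<gamma> \<theta>'" "worst_case_cdf G \<epsilon> \<gamma> F" and t: "t \<in> {0<..<1::real}"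
      then have "\<theta>' = \<theta>" "F = H"
        using \<theta>_uniq wc by blast+
      \<comment> \<open>The link between angle and multiplier rewrites the shift and the slope of
        the affine map.\<close>
      then show "quantile F t = (\<mu>G + sqrt \<epsilon> * cos \<theta>')
          + (\<sigma>G + sqrt \<epsilon> * sin \<theta>') * ((quantile G t - \<mu>G) / \<sigma>G)"
        using H(3)[of t] t by (simp add: l(2,3))
    qed
    have "(SUP F\<in>W2_ball G \<epsilon>. mean_var \<gamma> F) = V"
      using H(1,2) max by (intro cSup_eq_maximum) auto
    then show "\<forall>l. multiplier_root \<sigma>G \<epsilon> \<gamma> l \<longrightarrow>
       (SUP F\<in>W2_ball G \<epsilon>. mean_var \<gamma> F) =
         \<mu>G + l * \<gamma> / (l - \<gamma>) * \<sigma>G\<^sup>2 + 1 / (4 * l) + l * \<epsilon>"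
      using l_uniq unfolding V_def by blast
  qed
qed

end
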